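(* Let $p$ be a selective ultrafilter on $\omega$, let $Z$ be a set, and let $\langle u_n : n<\omega\rangle$ and $\langle v_n : n<\omega\rangle$ be two $p$-injective sequences of ultrafilters on $Z$. Then $p\text{-}\lim_n u_n=p\text{-}\lim_n v_n$ if and only if $\{n<\omega : u_n=v_n\}\in p$.
   Context: A nonprincipal ultrafilter $p$ on $\omega$ is selective if for every partition $\omega=\bigcup_{n<\omega}X_n$ either some $X_n\in p$ or there is $A\in p$ with $|A\cap X_n|\le1$ for all $n$. For an ultrafilter $p$ on $\omega$ and ultrafilters $u_n$ on $Z$, $p\text{-}\lim_n u_n=\{A\subseteq Z : \{n : A\in u_n\}\in p\}$. A sequence $\langle u_n\rangle$ is $p$-injective if there is $A\in p$ such that $u_n\ne u_m$ for all distinct $n,m\in A$. *)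

theory Defs
  imports Main "HOL-Library.Disjoint_Sets"
begin

text \<open>
  An ultrafilter on a set Z is a family of subsets of Z. The relative formulation, rather than
  the type of filters over a type, keeps the underlying set Z arbitrary. Families on
  the natural numbers are families on \<open>UNIV :: nat set\<close>.
\<close>

definition ultrafilter_on :: "'a set \<Rightarrow> 'a set set \<Rightarrow> bool" where
  "ultrafilter_on Z U \<longleftrightarrow>
     U \<subseteq> Pow Z \<and> Z \<in> U \<and> {} \<notin> U \<and>
     (\<forall>A\<in>U. \<forall>B\<in>U. A \<inter> B \<in> U) \<and>
     (\<forall>A\<in>U. \<forall>B. A \<subseteq> B \<and> B \<subseteq> Z \<longrightarrow> B \<in> U) \<and>
     (\<forall>A. A \<subseteq> Z \<longrightarrow> A \<in> U \<or> Z - A \<in> U)"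

definition principal_ultrafilter :: "'a set \<Rightarrow> 'a \<Rightarrow> 'a set set" where
  "principal_ultrafilter Z x = {A. A \<subseteq> Z \<and> x \<in> A}"

definition nonprincipal_ultrafilter_on :: "'a set \<Rightarrow> 'a set set \<Rightarrow> bool" where
  "nonprincipal_ultrafilter_on Z U \<longleftrightarrow>
     ultrafilter_on Z U \<and> (\<forall>x\<in>Z. U \<noteq> principal_ultrafilter Z x)"

text \<open>
  The pieces \<open>X n\<close> of a partition may be empty, so finite partitions are covered as well. Finiteness
  is required explicitly because the cardinality of an infinite set is 0.
\<close>

definition selective_ultrafilter :: "nat set set \<Rightarrow> bool" where
  "selective_ultrafilter p \<longleftrightarrow>
     nonprincipal_ultrafilter_on UNIV p \<and>
     (\<forall>X :: nat \<Rightarrow> nat set. disjoint_family X \<and> (\<Union>n. X n) = UNIV \<longrightarrow>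
        (\<exists>n. X n \<in> p) \<or>
        (\<exists>A\<in>p. \<forall>n. finite (A \<inter> X n) \<and> card (A \<inter> X n) \<le> 1))"

definition ultrafilter_lim :: "'a set \<Rightarrow> nat set set \<Rightarrow> (nat \<Rightarrow> 'a set set) \<Rightarrow> 'a set set" where
  "ultrafilter_lim Z p u = {A. A \<subseteq> Z \<and> {n. A \<in> u n} \<in> p}"

definition p_injective :: "nat set set \<Rightarrow> (nat \<Rightarrow> 'b) \<Rightarrow> bool" where
  "p_injective p u \<longleftrightarrow> (\<exists>A\<in>p. inj_on u A)"

end

theory Submission
  imports Defs
begin

text \<open>
  Suppose both limits equal \<open>q\<close> although \<open>u n \<noteq> v n\<close> for \<open>p\<close>-almost all \<open>n\<close>. By \<open>p\<close>-injectivity,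
  \<open>u n\<close> and \<open>v n\<close> differ from \<open>q\<close> almost always, so there is \<open>E n \<in> u n \<inter> v n\<close> outside \<open>q\<close>; then
  \<open>E n\<close> belongs to neither \<open>u m\<close> nor \<open>v m\<close> for almost all \<open>m\<close>. A selective ultrafilter is closed
  under diagonal intersections, which gives \<open>B \<in> p\<close> such that this holds for all \<open>n < m\<close> in \<open>B\<close>.
  Removing from each \<open>E m\<close> the earlier \<open>E n\<close> yields pairwise disjoint sets, each of which splits
  into a member of \<open>u m\<close> and a member of \<open>v m\<close>. The unions of these two kinds of pieces are
  disjoint members of \<open>q\<close>.
\<close>

section \<open>Ultrafilters on a set\<close>

lemma ultrafilter_on_subset:
  assumes "ultrafilter_on Z U" "A \<in> U"
  shows "A \<subseteq> Z"
  using assms by (auto simp: ultrafilter_on_def)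

lemma ultrafilter_on_empty:
  assumes "ultrafilter_on Z U"
  shows "{} \<notin> U"
  using assms by (auto simp: ultrafilter_on_def)

lemma ultrafilter_on_top:
  assumes "ultrafilter_on Z U"
  shows "Z \<in> U"
  using assms by (auto simp: ultrafilter_on_def)

lemma ultrafilter_on_Int:
  assumes "ultrafilter_on Z U" "A \<in> U" "B \<in> U"
  shows "A \<inter> B \<in> U"
  using assms by (simp add: ultrafilter_on_def)

lemma ultrafilter_on_mono:
  assumes "ultrafilter_on Z U" "A \<in> U" "A \<subseteq> B" "B \<subseteq> Z"
  shows "B \<in> U"
  using assms unfolding ultrafilter_on_def by blast

lemma ultrafilter_on_Diff_iff:
  assumes U: "ultrafilter_on Z U" and A: "A \<subseteq> Z"
  shows "Z - A \<in> U \<longleftrightarrow> A \<notin> U"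
proof
  assume "Z - A \<in> U"
  show "A \<notin> U"
  proof
    assume "A \<in> U"
    then have "A \<inter> (Z - A) \<in> U"
      using ultrafilter_on_Int[OF U] \<open>Z - A \<in> U\<close> by blast
    then show False
      using ultrafilter_on_empty[OF U] by simp
  qed
next
  assume "A \<notin> U"
  then show "Z - A \<in> U"
    using assms unfolding ultrafilter_on_def by blast
qed

lemma ultrafilter_on_Un_iff:
  assumes U: "ultrafilter_on Z U" and A: "A \<subseteq> Z" and B: "B \<subseteq> Z"
  shows "A \<union> B \<in> U \<longleftrightarrow> A \<in> U \<or> B \<in> U"
proof
  assume AB: "A \<union> B \<in> U"
  show "A \<in> U \<or> B \<in> U"
  proof (rule ccontr)
    assume "\<not> (A \<in> U \<or> B \<in> U)"
    then have "(Z - A) \<inter> (Z - B) \<in> U"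
      using ultrafilter_on_Int[OF U] ultrafilter_on_Diff_iff[OF U] A B by blast
    moreover have "(Z - A) \<inter> (Z - B) = Z - (A \<union> B)" by blast
    ultimately show False
      using ultrafilter_on_Diff_iff[OF U, of "A \<union> B"] A B AB by simp
  qed
qed (use ultrafilter_on_mono[OF U] A B in blast)

lemma ultrafilter_on_finite_UN:
  assumes U: "ultrafilter_on Z U" and "finite I" "\<And>i. i \<in> I \<Longrightarrow> X i \<subseteq> Z"
    and "(\<Union>i\<in>I. X i) \<in> U"
  shows "\<exists>i\<in>I. X i \<in> U"
  using assms(2-)
proof (induction I rule: finite_induct)
  case empty
  then show ?case using ultrafilter_on_empty[OF U] by simp
next
  case (insert i I)
  then have "X i \<subseteq> Z" "(\<Union>j\<in>I. X j) \<subseteq> Z" "X i \<union> (\<Union>j\<in>I. X j) \<in> U"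
    by auto
  with ultrafilter_on_Un_iff[OF U this(1,2)] insert show ?case by auto
qed

text \<open>Maximality: if \<open>U\<close> is contained in \<open>V\<close>, the complement of any
  member of \<open>V - U\<close> separates in the required direction.\<close>

lemma ultrafilter_on_separate:
  assumes U: "ultrafilter_on Z U" and V: "ultrafilter_on Z V" and "U \<noteq> V"
  obtains A where "A \<in> U" "A \<notin> V" "A \<subseteq> Z"
proof (cases "U \<subseteq> V")
  case True
  with \<open>U \<noteq> V\<close> obtain B where B: "B \<in> V" "B \<notin> U" by blast
  then have "B \<subseteq> Z" using ultrafilter_on_subset[OF V] by blast
  then show thesis
    using that[of "Z - B"] B ultrafilter_on_Diff_iff[OF U] ultrafilter_on_Diff_iff[OF V] by blast
next
  case False
  then show thesis using that ultrafilter_on_subset[OF U] by blast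
qed

text \<open>Splitting a finite member into points puts some singleton into \<open>p\<close>, and a
  singleton member makes \<open>p\<close> principal.\<close>

lemma nonprincipal_ultrafilter_on_finite:
  assumes p: "nonprincipal_ultrafilter_on Z p" and "finite A"
  shows "A \<notin> p"
proof
  have U: "ultrafilter_on Z p" using p by (simp add: nonprincipal_ultrafilter_on_def)
  assume "A \<in> p"
  then have AZ: "A \<subseteq> Z" using ultrafilter_on_subset[OF U] by blast
  have "\<exists>x\<in>A. {x} \<in> p"
    by (rule ultrafilter_on_finite_UN[OF U \<open>finite A\<close>]) (use AZ \<open>A \<in> p\<close> in auto)
  then obtain x where x: "x \<in> Z" "{x} \<in> p" using AZ by blast
  have "p = principal_ultrafilter Z x"
  proof (intro set_eqI iffI)
    fix B assume B: "B \<in> p"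
    then have "B \<inter> {x} \<in> p" using ultrafilter_on_Int[OF U] x by blast
    then have "x \<in> B" using ultrafilter_on_empty[OF U] by (cases "x \<in> B") simp_all
    then show "B \<in> principal_ultrafilter Z x"
      using ultrafilter_on_subset[OF U B] by (simp add: principal_ultrafilter_def)
  next
    fix B assume "B \<in> principal_ultrafilter Z x"
    then show "B \<in> p"
      using ultrafilter_on_mono[OF U x(2)] by (simp add: principal_ultrafilter_def)
  qed
  then show False using p x(1) unfolding nonprincipal_ultrafilter_on_def by blast
qed

lemma ultrafilter_on_lim:
  assumes p: "ultrafilter_on UNIV p" and u: "\<And>n. ultrafilter_on Z (u n)"
  shows "ultrafilter_on Z (ultrafilter_lim Z p u)"
  unfolding ultrafilter_on_def
proof (intro conjI ballI allI impI)
  show "ultrafilter_lim Z p u \<subseteq> Pow Z"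
    by (auto simp: ultrafilter_lim_def)
  show "Z \<in> ultrafilter_lim Z p u"
    using ultrafilter_on_top[OF u] ultrafilter_on_top[OF p] by (simp add: ultrafilter_lim_def)
  show "{} \<notin> ultrafilter_lim Z p u"
    using ultrafilter_on_empty[OF u] ultrafilter_on_empty[OF p] by (simp add: ultrafilter_lim_def)
next
  fix A B assume "A \<in> ultrafilter_lim Z p u" "B \<in> ultrafilter_lim Z p u"
  then have AB: "A \<subseteq> Z" "{n. A \<in> u n} \<inter> {n. B \<in> u n} \<in> p"
    using ultrafilter_on_Int[OF p] by (auto simp: ultrafilter_lim_def)
  have "{n. A \<inter> B \<in> u n} \<in> p"
    by (rule ultrafilter_on_mono[OF p AB(2)]) (use ultrafilter_on_Int[OF u] in auto)
  with AB show "A \<inter> B \<in> ultrafilter_lim Z p u" by (auto simp: ultrafilter_lim_def)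
next
  fix A B assume A: "A \<in> ultrafilter_lim Z p u" and B: "A \<subseteq> B \<and> B \<subseteq> Z"
  then have A': "{n. A \<in> u n} \<in> p" by (simp add: ultrafilter_lim_def)
  have "{n. B \<in> u n} \<in> p"
    by (rule ultrafilter_on_mono[OF p A']) (use B ultrafilter_on_mono[OF u] in auto)
  with B show "B \<in> ultrafilter_lim Z p u" by (simp add: ultrafilter_lim_def)
next
  fix A assume A: "A \<subseteq> Z"
  have "{n. Z - A \<in> u n} = UNIV - {n. A \<in> u n}"
    using ultrafilter_on_Diff_iff[OF u A] by auto
  then show "A \<in> ultrafilter_lim Z p u \<or> Z - A \<in> ultrafilter_lim Z p u"
    using ultrafilter_on_Diff_iff[OF p, of "{n. A \<in> u n}"] A by (auto simp: ultrafilter_lim_def)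
qed

text \<open>One inclusion suffices, since the hypothesis is symmetric in \<open>u\<close> and
  \<open>v\<close>.\<close>

lemma ultrafilter_lim_cong_subset:
  assumes p: "ultrafilter_on UNIV p" and eq: "{n. u n = v n} \<in> p"
  shows "ultrafilter_lim Z p u \<subseteq> ultrafilter_lim Z p v"
proof
  fix A assume "A \<in> ultrafilter_lim Z p u"
  then have A: "A \<subseteq> Z" "{n. A \<in> u n} \<inter> {n. u n = v n} \<in> p"
    using ultrafilter_on_Int[OF p] eq by (auto simp: ultrafilter_lim_def)
  have "{n. A \<in> v n} \<in> p"
    by (rule ultrafilter_on_mono[OF p A(2)]) auto
  with A show "A \<in> ultrafilter_lim Z p v" by (simp add: ultrafilter_lim_def)
qed

text \<open>On a member of \<open>p\<close> where \<open>u\<close> is injective, the value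
  \<open>q\<close> occurs at most once, and nonprincipality excludes finite sets from
  \<open>p\<close>.\<close>

lemma p_injective_neq:
  assumes p: "nonprincipal_ultrafilter_on UNIV p" and "p_injective p u"
  shows "{n. u n \<noteq> q} \<in> p"
proof -
  have U: "ultrafilter_on UNIV p" using p by (simp add: nonprincipal_ultrafilter_on_def)
  obtain A where A: "A \<in> p" "inj_on u A" using assms(2) by (auto simp: p_injective_def)
  have "finite (A \<inter> {n. u n = q})"
    by (rule inj_on_finite[of u _ "{q}"]) (use A(2) in \<open>auto simp: inj_on_def\<close>)
  then have "{n. u n = q} \<notin> p"
    using nonprincipal_ultrafilter_on_finite[OF p] ultrafilter_on_Int[OF U A(1)] by blast
  then show ?thesis
    using ultrafilter_on_Diff_iff[OF U, of "{n. u n = q}"]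
    by (simp add: Collect_neg_eq Compl_eq_Diff_UNIV)
qed

section \<open>Diagonal intersections\<close>

text \<open>The fibres of \<open>g\<close> partition the natural numbers; a member of
  \<open>p\<close> meeting each fibre at most once is a set on which \<open>g\<close> is
  injective.\<close>

lemma selective_ultrafilter_inj_on:
  fixes g :: "nat \<Rightarrow> nat"
  assumes "selective_ultrafilter p" and fib: "\<And>k. {m. g m = k} \<notin> p"
  shows "\<exists>A\<in>p. inj_on g A"
proof -
  let ?X = "\<lambda>k. {m. g m = k}"
  have "disjoint_family ?X \<and> (\<Union>k. ?X k) = UNIV"
    by (auto simp: disjoint_family_on_def)
  then obtain A where A: "A \<in> p" "\<And>k. finite (A \<inter> ?X k) \<and> card (A \<inter> ?X k) \<le> 1"
    using assms unfolding selective_ultrafilter_def by metis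
  have "inj_on g A"
  proof (rule inj_onI)
    fix x y assume "x \<in> A" "y \<in> A" "g x = g y"
    then have "x \<in> A \<inter> ?X (g x)" "y \<in> A \<inter> ?X (g x)" by auto
    with A(2)[of "g x"] show "x = y" by (metis One_nat_def card_le_Suc0_iff_eq)
  qed
  with A show ?thesis by blast
qed

text \<open>
  Selectivity is used twice: injectivity of \<open>g\<close> on \<open>A\<close> leaves only finitely many exceptions
  \<open>m \<in> A - S n\<close> for each \<open>n\<close>, all below \<open>F n\<close>. Injectivity of \<open>h\<close>, together with a fixed parity of
  its values, then puts distinct points into non-adjacent intervals between consecutive \<open>e k\<close>,
  so that \<open>n < m\<close> already implies that \<open>m\<close> is beyond the exceptions for \<open>n\<close>.
\<close>
lemma selective_ultrafilter_diagonal: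
  assumes sel: "selective_ultrafilter p" and S: "\<And>n. S n \<in> p"
  obtains B where "B \<in> p" "\<And>n m. n \<in> B \<Longrightarrow> m \<in> B \<Longrightarrow> n < m \<Longrightarrow> m \<in> S n"
proof -
  have np: "nonprincipal_ultrafilter_on UNIV p"
    using sel by (simp add: selective_ultrafilter_def)
  then have U: "ultrafilter_on UNIV p" by (simp add: nonprincipal_ultrafilter_on_def)
  \<comment> \<open>\<open>g m\<close> is the first \<open>k < m\<close> with \<open>m\<close>
    outside \<open>S k\<close>; the disjunct \<open>m \<le> k\<close> supplies the default value
    \<open>m\<close> when there is none.\<close>
  define g where "g m = (LEAST k. m \<le> k \<or> m \<notin> S k)" for m
  have g: "m \<le> g m \<or> m \<notin> S (g m)" for m
    unfolding g_def by (rule LeastI[of _ m]) simp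
  have g_less: "m \<in> S n" if "n < g m" for m n
    using not_less_Least[of n "\<lambda>k. m \<le> k \<or> m \<notin> S k"] that by (simp add: g_def)
  have "{m. g m = k} \<notin> p" for k
  proof
    assume "{m. g m = k} \<in> p"
    then have "{m. g m = k} \<inter> S k \<in> p" using ultrafilter_on_Int[OF U] S by blast
    moreover have "{m. g m = k} \<inter> S k \<subseteq> {..k}" using g by auto
    ultimately show False
      using nonprincipal_ultrafilter_on_finite[OF np] finite_subset finite_atMost by blast
  qed
  then obtain A where A: "A \<in> p" "inj_on g A"
    using selective_ultrafilter_inj_on[OF sel] by blast
  have "\<exists>N. \<forall>m\<in>A. g m \<le> n \<longrightarrow> m < N" for n
  proof -
    have "finite {m \<in> A. g m \<le> n}"
      by (rule inj_on_finite[of g _ "{..n}"]) (use A(2) in \<open>auto simp: inj_on_def\<close>)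
    then show ?thesis by (auto simp: finite_nat_set_iff_bounded)
  qed
  then obtain F where F: "\<And>n m. m \<in> A \<Longrightarrow> g m \<le> n \<Longrightarrow> m < F n" by metis
  \<comment> \<open>The argument \<open>F x\<close> pushes each value of \<open>e\<close> past the
    exceptions for the previous one; \<open>Suc x\<close> keeps \<open>e\<close> strictly
    increasing.\<close>
  define e where "e = rec_nat 0 (\<lambda>_ x. max (Suc x) (F x))"
  have e_Suc: "e (Suc k) = max (Suc (e k)) (F (e k))" for k
    by (simp add: e_def)
  have e: "strict_mono e"
    by (rule strict_mono_Suc_iff[THEN iffD2]) (simp add: e_Suc less_max_iff_disj)
  \<comment> \<open>Since \<open>e 0 = 0\<close>, \<open>h m\<close> is positive and
    \<open>m\<close> lies in the interval from \<open>e (h m - 1)\<close> up to, but excluding,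
    \<open>e (h m)\<close>.\<close>
  define h where "h m = (LEAST k. m < e k)" for m
  have h: "m < e (h m)" for m
    unfolding h_def
    by (rule LeastI[of _ "Suc m"]) (use strict_mono_imp_increasing[OF e, of "Suc m"] in simp)
  have h_less: "e k \<le> m" if "k < h m" for m k
    using not_less_Least[of k "\<lambda>k. m < e k"] that by (simp add: h_def)
  have "{m. h m = k} \<notin> p" for k
  proof -
    have "{m. h m = k} \<subseteq> {..<e k}" using h by auto
    then show ?thesis
      using nonprincipal_ultrafilter_on_finite[OF np] finite_subset finite_lessThan by blast
  qed
  then obtain C where C: "C \<in> p" "inj_on h C"
    using selective_ultrafilter_inj_on[OF sel] by blast
  obtain P where P: "P \<in> p" "\<And>n m. n \<in> P \<Longrightarrow> m \<in> P \<Longrightarrow> even (h n) \<longleftrightarrow> even (h m)"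
    using ultrafilter_on_Diff_iff[OF U, of "{m. even (h m)}"] by blast
  show thesis
  proof (rule that)
    show "A \<inter> C \<inter> P \<in> p" using A C P ultrafilter_on_Int[OF U] by blast
  next
    fix n m assume nm: "n \<in> A \<inter> C \<inter> P" "m \<in> A \<inter> C \<inter> P" "n < m"
    have "h n \<noteq> h m" using nm C(2) by (auto dest: inj_onD)
    moreover have "h n \<le> h m"
      using h[of m] h_less[of "h m" n] nm(3) by (meson leI less_le_trans less_asym)
    moreover have "even (h n) \<longleftrightarrow> even (h m)" using P(2) nm by blast
    \<comment> \<open>Equal parity turns \<open>h n < h m\<close> into a gap of at least 2. Hence
      \<open>m\<close> is at least \<open>e (Suc (h n))\<close>, which bounds
      \<open>F (e (h n))\<close>, so \<open>g m\<close> exceeds \<open>e (h n) > n\<close>.\<close>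
    ultimately have "Suc (h n) < h m"
      by (metis Suc_lessI even_Suc le_neq_implies_less)
    then have "F (e (h n)) \<le> m" using h_less[of "Suc (h n)" m] by (simp add: e_Suc)
    then have "e (h n) < g m" using F[of m "e (h n)"] nm by force
    with h[of n] show "m \<in> S n" by (intro g_less) simp
  qed
qed

section \<open>Equality of limits\<close>

lemma ultrafilter_lim_neq:
  assumes sel: "selective_ultrafilter p"
    and u: "\<And>n. ultrafilter_on Z (u n)" and v: "\<And>n. ultrafilter_on Z (v n)"
    and iu: "p_injective p u" and iv: "p_injective p v"
    and neq: "{n. u n \<noteq> v n} \<in> p"
  shows "ultrafilter_lim Z p u \<noteq> ultrafilter_lim Z p v"
proof
  assume lim_eq: "ultrafilter_lim Z p u = ultrafilter_lim Z p v"
  define q where "q = ultrafilter_lim Z p u"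
  have q_def': "q = ultrafilter_lim Z p v"
    unfolding q_def by (rule lim_eq)
  have np: "nonprincipal_ultrafilter_on UNIV p"
    using sel by (simp add: selective_ultrafilter_def)
  then have U: "ultrafilter_on UNIV p" by (simp add: nonprincipal_ultrafilter_on_def)
  have q: "ultrafilter_on Z q"
    unfolding q_def by (rule ultrafilter_on_lim[OF U u])
  have q_u: "A \<in> q \<longleftrightarrow> A \<subseteq> Z \<and> {n. A \<in> u n} \<in> p"
    and q_v: "A \<in> q \<longleftrightarrow> A \<subseteq> Z \<and> {n. A \<in> v n} \<in> p" for A
    by (simp add: q_def ultrafilter_lim_def, simp add: q_def' ultrafilter_lim_def)
  define D where "D = {n. u n \<noteq> q} \<inter> {n. v n \<noteq> q} \<inter> {n. u n \<noteq> v n}"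
  have D: "D \<in> p"
    unfolding D_def by (intro ultrafilter_on_Int[OF U] p_injective_neq[OF np] iu iv neq)
  \<comment> \<open>Outside \<open>D\<close> both sets are empty, so that
    \<open>G \<union> H \<notin> q\<close> holds for every \<open>n\<close>; the diagonal lemma
    needs \<open>S n \<in> p\<close> without exception.\<close>
  have "\<exists>G H. G \<subseteq> Z \<and> H \<subseteq> Z \<and> G \<union> H \<notin> q \<and> (n \<in> D \<longrightarrow> G \<in> u n \<and> H \<in> v n \<and> G \<inter> H = {})" for n
  proof (cases "n \<in> D")
    case True
    then have ne: "u n \<noteq> q" "v n \<noteq> q" "u n \<noteq> v n" by (auto simp: D_def)
    obtain G where G: "G \<in> u n" "G \<notin> q" "G \<subseteq> Z" by (rule ultrafilter_on_separate[OF u q ne(1)])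
    obtain H where H: "H \<in> v n" "H \<notin> q" "H \<subseteq> Z" by (rule ultrafilter_on_separate[OF v q ne(2)])
    \<comment> \<open>Cutting \<open>G\<close> by \<open>K\<close> and \<open>H\<close> by the
      complement of \<open>K\<close> makes them disjoint while keeping them in \<open>u n\<close>
      and \<open>v n\<close>.\<close>
    obtain K where K: "K \<in> u n" "K \<notin> v n" "K \<subseteq> Z" by (rule ultrafilter_on_separate[OF u v ne(3)])
    have "G \<inter> K \<in> u n" using ultrafilter_on_Int[OF u] G K by blast
    moreover have "H \<inter> (Z - K) \<in> v n"
      using ultrafilter_on_Int[OF v] ultrafilter_on_Diff_iff[OF v] H K by blast
    moreover have "(G \<inter> K) \<union> (H \<inter> (Z - K)) \<notin> q"
      using ultrafilter_on_Un_iff[OF q G(3) H(3)] G H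
        ultrafilter_on_mono[OF q, of "(G \<inter> K) \<union> (H \<inter> (Z - K))" "G \<union> H"] by blast
    ultimately show ?thesis using G H by (intro exI[of _ "G \<inter> K"] exI[of _ "H \<inter> (Z - K)"]) blast
  next
    case False
    then show ?thesis using ultrafilter_on_empty[OF q] by (intro exI[of _ "{}"]) simp
  qed
  then obtain G H where GZ: "\<And>n. G n \<subseteq> Z" and HZ: "\<And>n. H n \<subseteq> Z"
    and GHq: "\<And>n. G n \<union> H n \<notin> q"
    and G: "\<And>n. n \<in> D \<Longrightarrow> G n \<in> u n" and H: "\<And>n. n \<in> D \<Longrightarrow> H n \<in> v n"
    and GH: "\<And>n. n \<in> D \<Longrightarrow> G n \<inter> H n = {}"
    by metis
  define E where "E n = G n \<union> H n" for n
  have EZ: "E n \<subseteq> Z" for n using GZ HZ by (auto simp: E_def)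
  define S where "S n = {m. E n \<notin> u m} \<inter> {m. E n \<notin> v m}" for n
  have "S n \<in> p" for n
  proof -
    have "{m. E n \<in> u m} \<notin> p" "{m. E n \<in> v m} \<notin> p"
      using GHq[of n] EZ q_u[of "E n"] q_v[of "E n"] by (auto simp: E_def)
    then have "UNIV - {m. E n \<in> u m} \<in> p" "UNIV - {m. E n \<in> v m} \<in> p"
      using ultrafilter_on_Diff_iff[OF U] by blast+
    then have "(UNIV - {m. E n \<in> u m}) \<inter> (UNIV - {m. E n \<in> v m}) \<in> p"
      by (rule ultrafilter_on_Int[OF U])
    moreover have "(UNIV - {m. E n \<in> u m}) \<inter> (UNIV - {m. E n \<in> v m}) = S n"
      by (auto simp: S_def)
    ultimately show ?thesis by simp
  qed
  then obtain B where B: "B \<in> p" "\<And>n m. n \<in> B \<Longrightarrow> m \<in> B \<Longrightarrow> n < m \<Longrightarrow> m \<in> S n"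
    by (rule selective_ultrafilter_diagonal[where S = S, OF sel]) blast
  define C where "C = B \<inter> D"
  have C: "C \<in> p" using B D ultrafilter_on_Int[OF U] by (simp add: C_def)
  define R where "R m = (\<Union>n\<in>{n\<in>C. n < m}. E n)" for m
  have RZ: "R m \<subseteq> Z" for m using EZ by (auto simp: R_def)
  \<comment> \<open>\<open>R m\<close> is a finite union, so membership in \<open>w\<close> would
    give a single earlier \<open>E n\<close> in \<open>w\<close>, contrary to
    \<open>m \<in> S n\<close>.\<close>
  have R: "R m \<notin> w" if "m \<in> C" "ultrafilter_on Z w" "w = u m \<or> w = v m" for m w
  proof
    assume "R m \<in> w"
    then have "\<exists>n\<in>{n\<in>C. n < m}. E n \<in> w"
      unfolding R_def by (intro ultrafilter_on_finite_UN[OF that(2)]) (use EZ in auto)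
    then show False using B(2) that by (auto simp: C_def S_def)
  qed
  define G' where "G' = (\<Union>m\<in>C. G m - R m)"
  define H' where "H' = (\<Union>m\<in>C. H m - R m)"
  have "G' \<in> u m" if m: "m \<in> C" for m
  proof -
    have "G m \<inter> (Z - R m) \<in> u m"
      using R[OF m u] ultrafilter_on_Diff_iff[OF u RZ] G ultrafilter_on_Int[OF u] m
      by (simp add: C_def)
    then show ?thesis
      by (rule ultrafilter_on_mono[OF u]) (use GZ m in \<open>auto simp: G'_def\<close>)
  qed
  then have "{m. G' \<in> u m} \<in> p"
    by (intro ultrafilter_on_mono[OF U C]) auto
  then have G'q: "G' \<in> q" using q_u GZ by (auto simp: G'_def)
  have "H' \<in> v m" if m: "m \<in> C" for m
  proof -
    have "H m \<inter> (Z - R m) \<in> v m"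
      using R[OF m v] ultrafilter_on_Diff_iff[OF v RZ] H ultrafilter_on_Int[OF v] m
      by (simp add: C_def)
    then show ?thesis
      by (rule ultrafilter_on_mono[OF v]) (use HZ m in \<open>auto simp: H'_def\<close>)
  qed
  then have "{m. H' \<in> v m} \<in> p"
    by (intro ultrafilter_on_mono[OF U C]) auto
  then have H'q: "H' \<in> q" using q_v HZ by (auto simp: H'_def)
  have "G' \<inter> H' = {}"
  proof (rule ccontr)
    assume "G' \<inter> H' \<noteq> {}"
    then obtain x n m where x: "n \<in> C" "m \<in> C" "x \<in> G n" "x \<notin> R n" "x \<in> H m" "x \<notin> R m"
      by (auto simp: G'_def H'_def)
    \<comment> \<open>If \<open>n < m\<close>, then \<open>x \<in> G n\<close> puts \<open>x\<close>
      into \<open>R m\<close>; if \<open>m < n\<close>, then \<open>x \<in> H m\<close> puts it into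
      \<open>R n\<close>. Only \<open>n = m\<close> remains, where \<open>G n\<close> and
      \<open>H n\<close> are disjoint.\<close>
    then have "\<not> n < m" "\<not> m < n" by (auto simp: R_def E_def)
    with x GH[of n] show False by (auto simp: C_def)
  qed
  then show False
    using ultrafilter_on_Int[OF q G'q H'q] ultrafilter_on_empty[OF q] by simp
qed

theorem theorem3p6:
  fixes p :: "nat set set" and Z :: "'a set" and u v :: "nat \<Rightarrow> 'a set set"
  assumes "selective_ultrafilter p"
    and "\<And>n. ultrafilter_on Z (u n)"
    and "\<And>n. ultrafilter_on Z (v n)"
    and "p_injective p u"
    and "p_injective p v"
  shows "ultrafilter_lim Z p u = ultrafilter_lim Z p v \<longleftrightarrow> {n. u n = v n} \<in> p"
proof -
  have U: "ultrafilter_on UNIV p"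
    using assms(1) by (simp add: selective_ultrafilter_def nonprincipal_ultrafilter_on_def)
  show ?thesis
  proof
    assume eq: "{n. u n = v n} \<in> p"
    then have "{n. v n = u n} \<in> p" by (simp add: eq_commute)
    with eq show "ultrafilter_lim Z p u = ultrafilter_lim Z p v"
      by (simp add: ultrafilter_lim_cong_subset[OF U] subset_antisym)
  next
    assume "ultrafilter_lim Z p u = ultrafilter_lim Z p v"
    then have "{n. u n \<noteq> v n} \<notin> p"
      using ultrafilter_lim_neq[OF assms] by blast
    then show "{n. u n = v n} \<in> p"
      using ultrafilter_on_Diff_iff[OF U, of "{n. u n = v n}"]
      by (simp add: Collect_neg_eq Compl_eq_Diff_UNIV)
  qed
qed

end
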